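(* Let $\mathcal F,\mathcal U\subseteq\mathbb R^n$ be non-empty finite sets with $0\in\mathrm{int}\,\mathrm{co}\,\mathcal U$, and let $k\in\mathbb N$. Then $$c_k(\mathcal F,\mathcal U)=\sup\big\{c\in(0,1):\ 0\in(1-c)\,\mathrm{co}\,\mathcal U+c\,\mathrm{co}\,\mathcal F\big\}=\sup\Big\{c\in(0,1):\ \Big(-\frac{c}{1-c}\mathrm{co}\,\mathcal F\Big)\cap\mathrm{co}\,\mathcal U\ne\emptyset\Big\}>0.$$ In particular, $c_k(\mathcal F,\mathcal U)$ is independent of $k$.
   Context: $\mathbb N=\{1,2,\dots\}$; $\mathrm{co}$ denotes convex hull, $\mathrm{int}$ the interior, and $A+B=\{x+y:x\in A,\,y\in B\}$ the Minkowski sum. For non-empty finite sets $\mathcal F,\mathcal U\subseteq\mathbb R^n$ and $k\in\mathbb N$, $$c_k(\mathcal F,\mathcal U):=\sup\Bigg\{c\in(0,1):\ \int_{\mathbb R^n}\frac{\big(\sum_{u\in\mathcal F}e^{\langle ku,x\rangle}\big)^{-c/k}}{\big(\sum_{u\in\mathcal U}e^{\langle ku,x\rangle}\big)^{(1-c)/k}}\,dx<\infty\Bigg\}.$$ *)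

theory Defs
  imports "HOL-Analysis.Analysis" "HOL-Library.Set_Algebras"
begin

text \<open>
  The supremum is taken in the extended reals, so that it has its usual meaning
  (\<open>Sup {} = - \<infinity>\<close>) for the empty set too; on \<^typ>\<open>real\<close> the value of \<open>Sup {}\<close> would be
  unspecified. The integrand is nonnegative, so its integral is the nonnegative Lebesgue integral.
\<close>

definition c_exponent :: "nat \<Rightarrow> (real ^ 'n) set \<Rightarrow> (real ^ 'n) set \<Rightarrow> ereal" where
  "c_exponent k F U = (SUP c \<in> {c::real. 0 < c \<and> c < 1 \<and>
     (\<integral>\<^sup>+ x. ennreal
        ((\<Sum>u\<in>F. exp ((real k *\<^sub>R u) \<bullet> x)) powr (- c / real k) /
         (\<Sum>u\<in>U. exp ((real k *\<^sub>R u) \<bullet> x)) powr ((1 - c) / real k)) \<partial>lborel) < \<infinity>}.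
     ereal c)"

end

theory Submission
  imports Defs "HOL-Real_Asymp.Real_Asymp"
begin

text \<open>
  Write \<open>h\<^sub>A x\<close> for the maximum of \<open>u \<bullet> x\<close> over \<open>u \<in> A\<close>, the support function of the convex hull
  of \<open>A\<close>. A sum of exponentials is comparable to its largest term, so up to constant factors the
  integrand is \<open>exp (- g\<^sub>c x)\<close> with \<open>g\<^sub>c = c h\<^sub>F + (1 - c) h\<^sub>U\<close>; the integer \<open>k\<close> only enters the
  constants, which is why the threshold cannot depend on it. The function \<open>g\<^sub>c\<close> is in turn the
  support function of \<open>K\<^sub>c = (1 - c) co U + c co F\<close>.

  If \<open>0\<close> is outside the compact convex set \<open>K\<^sub>c\<close>, a separating hyperplane gives a direction in which
  \<open>g\<^sub>c\<close> is negative. By homogeneity and continuity \<open>g\<^sub>c\<close> is then nonpositive on a whole cone around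
  this direction; the cone has infinite volume and the integral diverges
  (\<open>zero_in_combination_if_integral_finite\<close>).

  Conversely, \<open>0 \<in> K\<^sub>c\<close> gives \<open>g\<^sub>c \<ge> 0\<close>. This alone does not make the integral at \<open>c\<close> finite, but a
  supremum does not see the difference: for \<open>c' < c\<close> the function \<open>g\<^sub>c\<^sub>'\<close> is \<open>(c' / c) g\<^sub>c\<close> plus a
  positive multiple of \<open>h\<^sub>U\<close>, and \<open>h\<^sub>U x \<ge> r * norm x\<close> as soon as \<open>co U\<close> contains the ball of
  radius \<open>r\<close> about \<open>0\<close>. Hence the integrand at \<open>c'\<close> decays exponentially
  (\<open>integral_finite_below_combination\<close>).

  The second description of the threshold is the same condition on each \<open>c\<close>, solved for the point
  of \<open>co U\<close>. It holds for small \<open>c\<close>, since shrinking any point of \<open>- F\<close> far enough moves it into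
  \<open>co U\<close>; so the supremum is positive.
\<close>

section \<open>Support functions of finite sets\<close>

definition support_fun :: "'a::real_inner set \<Rightarrow> 'a \<Rightarrow> real" where
  "support_fun A x = Max ((\<lambda>u. u \<bullet> x) ` A)"

text \<open>
  Half-spaces are convex, so the bound passes from \<open>A\<close> to its hull: \<open>support_fun A\<close> is the support
  function of the polytope as well.
\<close>
lemma support_fun_upper:
  assumes "finite A" "v \<in> convex hull A"
  shows "v \<bullet> x \<le> support_fun A x"
proof -
  have "A \<subseteq> {v. x \<bullet> v \<le> support_fun A x}"
    unfolding support_fun_def using assms(1) by (auto simp: inner_commute[of x] intro!: Max_ge)
  then have "convex hull A \<subseteq> {v. x \<bullet> v \<le> support_fun A x}"
    by (intro hull_minimal convex_halfspace_le)
  with assms(2) show ?thesis by (auto simp: inner_commute)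
qed

lemma support_fun_attained:
  assumes "finite A" "A \<noteq> {}"
  obtains u where "u \<in> A" "support_fun A x = u \<bullet> x"
proof -
  have "Max ((\<lambda>u. u \<bullet> x) ` A) \<in> (\<lambda>u. u \<bullet> x) ` A"
    using assms by (intro Max_in) auto
  then show ?thesis using that unfolding support_fun_def by auto
qed

text \<open>
  Positive homogeneity, subadditivity and the Lipschitz bound in one estimate; it propagates
  negativity along a ray to a cone around the ray.
\<close>
lemma support_fun_perturbation:
  assumes "finite A" "A \<noteq> {}" "t \<ge> 0" "\<And>u. u \<in> A \<Longrightarrow> norm u \<le> M"
  shows "support_fun A (t *\<^sub>R x + y) \<le> t * support_fun A x + M * norm y"
proof -
  obtain u where u: "u \<in> A" "support_fun A (t *\<^sub>R x + y) = u \<bullet> (t *\<^sub>R x + y)"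
    using support_fun_attained[OF assms(1,2)] by metis
  have "u \<bullet> x \<le> support_fun A x"
    using u(1) assms(1) by (intro support_fun_upper hull_inc)
  then have "t * (u \<bullet> x) \<le> t * support_fun A x"
    using assms(3) by (rule mult_left_mono)
  moreover have "u \<bullet> y \<le> M * norm y"
    using norm_cauchy_schwarz[of u y] mult_right_mono[OF assms(4)[OF u(1)], of "norm y"] by simp
  ultimately show ?thesis using u(2) by (simp add: inner_add_right)
qed

text \<open>
  Test the support function against the boundary point of the ball in direction \<open>x\<close>.
\<close>
lemma support_fun_ge_norm:
  fixes A :: "'a::real_inner set"
  assumes "finite A" "cball 0 r \<subseteq> convex hull A" "r \<ge> 0"
  shows "r * norm x \<le> support_fun A x"
proof (cases "x = 0")
  case True
  have "(0::'a) \<in> convex hull A" using assms(2,3) by (auto simp: subset_iff)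
  from support_fun_upper[OF assms(1) this, of 0] True show ?thesis by simp
next
  case False
  have "(r / norm x) *\<^sub>R x \<in> convex hull A"
    using assms(2,3) False by (auto simp: subset_iff)
  from support_fun_upper[OF assms(1) this, of x] False show ?thesis
    by (simp add: dot_square_norm power2_eq_square)
qed

text \<open>
  The sum lies between its largest term and \<open>card A\<close> times that term. The largest term is
  \<open>exp (k * support_fun A x)\<close>, and the root in the exponent \<open>a / k\<close> cancels the \<open>k\<close>.
\<close>
lemma exp_sum_powr_bounds:
  fixes k :: nat
  assumes "finite A" "A \<noteq> {}" "k \<ge> 1" "a \<ge> 0"
  defines "S \<equiv> (\<lambda>x. \<Sum>u\<in>A. exp ((real k *\<^sub>R u) \<bullet> x))"
  shows "exp (a * support_fun A x) \<le> S x powr (a / real k)"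
    and "S x powr (a / real k) \<le> real (card A) powr (a / real k) * exp (a * support_fun A x)"
proof -
  have k: "real k > 0" using assms(3) by simp
  have e: "exp (real k * support_fun A x) powr (a / real k) = exp (a * support_fun A x)"
    using k by (simp add: exp_powr_real)
  obtain u where u: "u \<in> A" "support_fun A x = u \<bullet> x"
    using support_fun_attained[OF assms(1,2)] by metis
  have "exp (real k * support_fun A x) \<le> S x"
    unfolding S_def using u assms(1)
    by (auto intro!: member_le_sum[where f = "\<lambda>u. exp ((real k *\<^sub>R u) \<bullet> x)", of u, simplified])
  then show "exp (a * support_fun A x) \<le> S x powr (a / real k)"
    unfolding e[symmetric] using k assms(4) by (intro powr_mono2) auto
  have "S x \<le> real (card A) * exp (real k * support_fun A x)"
    unfolding S_def using k assms(1)
    by (intro sum_bounded_above) (auto intro!: support_fun_upper hull_inc)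
  moreover have "S x \<ge> 0" unfolding S_def by (intro sum_nonneg) auto
  ultimately have "S x powr (a / real k) \<le> (real (card A) * exp (real k * support_fun A x)) powr (a / real k)"
    using k assms(4) by (intro powr_mono2) auto
  then show "S x powr (a / real k) \<le> real (card A) powr (a / real k) * exp (a * support_fun A x)"
    by (simp add: powr_mult e)
qed

section \<open>Integrability of exponentials\<close>

lemma nn_integral_exp_neg_abs_finite:
  fixes a :: real
  assumes "a > 0"
  shows "(\<integral>\<^sup>+ x. ennreal (exp (- a * \<bar>x\<bar>)) \<partial>lborel) < \<infinity>"
proof -
  have half: "(\<integral>\<^sup>+ x. ennreal (exp (- a * x)) * indicator {0..} x \<partial>lborel) = ennreal (1 / a)"
  proof -
    have "(\<integral>\<^sup>+ x. ennreal (exp (- a * x)) * indicator {0..} x \<partial>lborel)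
        = ennreal (0 - (- exp (- a * 0) / a))"
    proof (rule nn_integral_FTC_atLeast)
      show "((\<lambda>x. - exp (- a * x) / a) \<longlongrightarrow> 0) at_top"
        using assms by real_asymp
    qed (use assms in \<open>auto intro!: derivative_eq_intros simp: field_simps\<close>)
    then show ?thesis by simp
  qed
  have "(\<integral>\<^sup>+ x. ennreal (exp (- a * \<bar>x\<bar>)) \<partial>lborel)
     \<le> (\<integral>\<^sup>+ x. (ennreal (exp (- a * x)) * indicator {0..} x
           + ennreal (exp (- a * (- x))) * indicator {0..} (- x)) \<partial>lborel)"
    by (intro nn_integral_mono) (auto simp: indicator_def)
  also have "\<dots> = (\<integral>\<^sup>+ x. ennreal (exp (- a * x)) * indicator {0..} x \<partial>lborel)
      + (\<integral>\<^sup>+ x. ennreal (exp (- a * (- x))) * indicator {0..} (- x) \<partial>lborel)"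
    by (intro nn_integral_add) auto
  also have "(\<integral>\<^sup>+ x. ennreal (exp (- a * (- x))) * indicator {0..} (- x) \<partial>lborel)
      = (\<integral>\<^sup>+ x. ennreal (exp (- a * x)) * indicator {0..} x \<partial>lborel)"
    using nn_integral_real_affine[of "\<lambda>x. ennreal (exp (- a * x)) * indicator {0..} x" "-1" 0]
    by simp
  finally show ?thesis unfolding half
    by (metis ennreal_add_eq_top ennreal_less_top infinity_ennreal_def order_le_less_trans top.not_eq_extremum)
qed

text \<open>
  The Euclidean norm dominates the average of the absolute values of the coordinates. This bounds
  the integrand by a product of one-variable exponentials, and Tonelli's theorem applies.
\<close>
lemma nn_integral_exp_neg_norm_finite:
  assumes "e > 0"
  shows "(\<integral>\<^sup>+ (x::'a::euclidean_space). ennreal (exp (- e * norm x)) \<partial>lborel) < \<infinity>"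
proof -
  define a where "a = e / real DIM('a)"
  have a: "a > 0" using assms by (simp add: a_def)
  have "(\<integral>\<^sup>+ (x::'a). ennreal (exp (- e * norm x)) \<partial>lborel)
      \<le> (\<integral>\<^sup>+ (x::'a). (\<Prod>b\<in>Basis. ennreal (exp (- a * \<bar>x \<bullet> b\<bar>))) \<partial>lborel)"
  proof (intro nn_integral_mono)
    fix x :: 'a
    have "(\<Sum>b\<in>Basis. \<bar>x \<bullet> b\<bar>) \<le> real DIM('a) * norm x"
      by (intro sum_bounded_above Basis_le_norm)
    then have "a * (\<Sum>b\<in>Basis. \<bar>x \<bullet> b\<bar>) \<le> e * norm x"
      using assms by (simp add: a_def field_simps mult_left_mono)
    then have "exp (- e * norm x) \<le> (\<Prod>b\<in>Basis. exp (- a * \<bar>x \<bullet> b\<bar>))"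
      by (simp add: exp_sum[symmetric] sum_negf sum_distrib_left)
    then show "ennreal (exp (- e * norm x)) \<le> (\<Prod>b\<in>Basis. ennreal (exp (- a * \<bar>x \<bullet> b\<bar>)))"
      by (simp add: prod_ennreal ennreal_leI)
  qed
  also have "\<dots> = (\<Prod>b\<in>(Basis::'a set). (\<integral>\<^sup>+ x. ennreal (exp (- a * \<bar>x\<bar>)) \<partial>lborel))"
    by (intro nn_integral_lborel_prod) auto
  also have "\<dots> < \<infinity>"
    using nn_integral_exp_neg_abs_finite[OF a] by (simp add: power_less_top_ennreal)
  finally show ?thesis .
qed

text \<open>
  The criterion for divergence on a cone, for which \<open>p t\<close> runs along the axis: balls of radius
  \<open>r * t\<close> suffice in place of the cone, because their volumes are already unbounded.
\<close>
lemma nn_integral_infinite_if_bounded_below_on_balls: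
  fixes f :: "'a::euclidean_space \<Rightarrow> real"
  assumes "C > 0" "r > 0"
    and "\<And>t y. t \<ge> 0 \<Longrightarrow> y \<in> ball (p t) (r * t) \<Longrightarrow> C \<le> f y"
  shows "(\<integral>\<^sup>+ x. ennreal (f x) \<partial>lborel) = \<infinity>"
proof (rule ccontr)
  assume "\<not> ?thesis"
  then obtain I where I: "I \<ge> 0" "(\<integral>\<^sup>+ x. ennreal (f x) \<partial>lborel) = ennreal I"
    by (metis ennreal_cases infinity_ennreal_def)
  define V where "V = unit_ball_vol (real DIM('a))"
  have V: "V > 0" unfolding V_def by (rule unit_ball_vol_pos) simp
  \<comment> \<open>The ball has volume \<open>V (r t)\<^sup>n \<ge> V r t\<close> once \<open>r t \<ge> 1\<close>; with this \<open>t\<close> its contribution to the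
    integral is at least \<open>I + 1\<close>.\<close>
  define t where "t = max 1 ((I + 1) / (C * V)) / r"
  have t: "t \<ge> 0" "r * t \<ge> 1" "(I + 1) / (C * V) \<le> r * t"
    using assms(2) by (auto simp: t_def)
  have "ennreal C * emeasure lborel (ball (p t) (r * t))
     = (\<integral>\<^sup>+ x. ennreal C * indicator (ball (p t) (r * t)) x \<partial>lborel)"
    by (simp add: nn_integral_cmult_indicator)
  also have "\<dots> \<le> (\<integral>\<^sup>+ x. ennreal (f x) \<partial>lborel)"
    using assms(3)[OF t(1)] by (intro nn_integral_mono) (auto simp: indicator_def intro!: ennreal_leI)
  also have "\<dots> = ennreal I" by (rule I(2))
  also have "emeasure lborel (ball (p t) (r * t)) = ennreal (V * (r * t) ^ DIM('a))"
    unfolding V_def using t by (intro emeasure_ball) auto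
  finally have "C * (V * (r * t) ^ DIM('a)) \<le> I"
    using I(1) assms(1) V t by (simp add: ennreal_mult[symmetric])
  moreover have "r * t \<le> (r * t) ^ DIM('a)"
    using t(2) by (simp add: self_le_power)
  then have "C * (V * (r * t)) \<le> C * (V * (r * t) ^ DIM('a))"
    using assms(1) V by (intro mult_left_mono) auto
  moreover have "I + 1 \<le> C * (V * (r * t))"
    using t(3) assms(1) V by (simp add: pos_divide_le_eq ac_simps)
  ultimately show False by simp
qed

section \<open>Finiteness of the integral and position of the origin\<close>

lemma integrand_upper:
  fixes F U :: "'a::real_inner set"
  assumes "finite F" "F \<noteq> {}" "finite U" "U \<noteq> {}" "k \<ge> 1" "0 < c" "c < 1"
  shows "(\<Sum>u\<in>F. exp ((real k *\<^sub>R u) \<bullet> x)) powr (- c / real k) /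
         (\<Sum>u\<in>U. exp ((real k *\<^sub>R u) \<bullet> x)) powr ((1 - c) / real k)
      \<le> exp (- (c * support_fun F x + (1 - c) * support_fun U x))" (is "?L \<le> ?R")
proof -
  have "exp (c * support_fun F x + (1 - c) * support_fun U x)
      \<le> (\<Sum>u\<in>F. exp ((real k *\<^sub>R u) \<bullet> x)) powr (c / real k) *
         (\<Sum>u\<in>U. exp ((real k *\<^sub>R u) \<bullet> x)) powr ((1 - c) / real k)"
    unfolding exp_add using assms by (intro mult_mono exp_sum_powr_bounds(1)) auto
  then have "inverse (\<dots>) \<le> inverse (exp (c * support_fun F x + (1 - c) * support_fun U x))"
    by (rule le_imp_inverse_le) simp
  then show ?thesis by (simp add: powr_minus exp_minus[symmetric] divide_inverse)
qed

lemma integrand_lower: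
  fixes F U :: "'a::real_inner set"
  assumes "finite F" "F \<noteq> {}" "finite U" "U \<noteq> {}" "k \<ge> 1" "0 < c" "c < 1"
  shows "inverse (real (card F) powr (c / real k) * real (card U) powr ((1 - c) / real k))
        * exp (- (c * support_fun F x + (1 - c) * support_fun U x))
      \<le> (\<Sum>u\<in>F. exp ((real k *\<^sub>R u) \<bullet> x)) powr (- c / real k) /
         (\<Sum>u\<in>U. exp ((real k *\<^sub>R u) \<bullet> x)) powr ((1 - c) / real k)"
proof -
  have pos: "(\<Sum>u\<in>A. exp ((real k *\<^sub>R u) \<bullet> x)) > 0" if "finite A" "A \<noteq> {}" for A
    using that by (intro sum_pos) auto
  have "(\<Sum>u\<in>F. exp ((real k *\<^sub>R u) \<bullet> x)) powr (c / real k) *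
         (\<Sum>u\<in>U. exp ((real k *\<^sub>R u) \<bullet> x)) powr ((1 - c) / real k)
    \<le> (real (card F) powr (c / real k) * exp (c * support_fun F x)) *
       (real (card U) powr ((1 - c) / real k) * exp ((1 - c) * support_fun U x))"
    using assms by (intro mult_mono exp_sum_powr_bounds(2)) auto
  also have "\<dots> = (real (card F) powr (c / real k) * real (card U) powr ((1 - c) / real k))
      * exp (c * support_fun F x + (1 - c) * support_fun U x)"
    by (simp add: exp_add)
  finally have "inverse \<dots> \<le> inverse ((\<Sum>u\<in>F. exp ((real k *\<^sub>R u) \<bullet> x)) powr (c / real k) *
         (\<Sum>u\<in>U. exp ((real k *\<^sub>R u) \<bullet> x)) powr ((1 - c) / real k))"
    using pos[OF assms(1,2)] pos[OF assms(3,4)] by (intro le_imp_inverse_le) auto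
  then show ?thesis
    by (simp add: powr_minus exp_minus[symmetric] divide_inverse)
qed

text \<open>
  If \<open>0\<close> were outside, a hyperplane would separate it strictly from the Minkowski sum; its inner normal
  \<open>a\<close> satisfies \<open>a \<bullet> v > b > 0\<close> on the sum, so the exponent is at most \<open>- b\<close> at \<open>- a\<close>. On the balls
  about \<open>- t a\<close> whose radius is a small multiple of \<open>t\<close> the integrand stays above a positive constant.
\<close>
lemma zero_in_combination_if_integral_finite:
  fixes F U :: "'a::euclidean_space set"
  assumes fin: "finite F" "F \<noteq> {}" "finite U" "U \<noteq> {}" and k: "k \<ge> 1" and c: "0 < c" "c < 1"
    and int: "(\<integral>\<^sup>+ x. ennreal
        ((\<Sum>u\<in>F. exp ((real k *\<^sub>R u) \<bullet> x)) powr (- c / real k) /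
         (\<Sum>u\<in>U. exp ((real k *\<^sub>R u) \<bullet> x)) powr ((1 - c) / real k)) \<partial>lborel) < \<infinity>"
  shows "0 \<in> (*\<^sub>R) (1 - c) ` (convex hull U) + (*\<^sub>R) c ` (convex hull F)"
proof (rule ccontr)
  let ?K = "(*\<^sub>R) (1 - c) ` (convex hull U) + (*\<^sub>R) c ` (convex hull F)"
  let ?g = "\<lambda>x. c * support_fun F x + (1 - c) * support_fun U x"
  assume "0 \<notin> ?K"
  moreover have "?K = convex hull ((*\<^sub>R) (1 - c) ` U + (*\<^sub>R) c ` F)"
    by (simp add: convex_hull_set_plus convex_hull_scaling)
  moreover have "compact (convex hull ((*\<^sub>R) (1 - c) ` U + (*\<^sub>R) c ` F))"
    using fin by (intro compact_convex_hull finite_imp_compact finite_set_plus) auto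
  ultimately obtain a b where ab: "b > 0" "\<And>x. x \<in> ?K \<Longrightarrow> a \<bullet> x > b"
    using separating_hyperplane_closed_0[of ?K] by (metis compact_imp_closed convex_convex_hull)
  have g: "?g (- a) \<le> - b"
  proof -
    obtain f where f: "f \<in> F" "support_fun F (- a) = f \<bullet> (- a)"
      using support_fun_attained fin by metis
    obtain u where u: "u \<in> U" "support_fun U (- a) = u \<bullet> (- a)"
      using support_fun_attained fin by metis
    have "(1 - c) *\<^sub>R u + c *\<^sub>R f \<in> ?K"
      using f u by (intro set_plus_intro imageI hull_inc)
    from ab(2)[OF this] show ?thesis
      by (simp add: f u inner_add_right inner_commute)
  qed
  obtain M where M: "M > 0" "\<And>u. u \<in> F \<union> U \<Longrightarrow> norm u \<le> M"
    using finite_imp_bounded[of "F \<union> U"] fin unfolding bounded_pos by auto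
  let ?C = "inverse (real (card F) powr (c / real k) * real (card U) powr ((1 - c) / real k))"
  have "(\<integral>\<^sup>+ x. ennreal
        ((\<Sum>u\<in>F. exp ((real k *\<^sub>R u) \<bullet> x)) powr (- c / real k) /
         (\<Sum>u\<in>U. exp ((real k *\<^sub>R u) \<bullet> x)) powr ((1 - c) / real k)) \<partial>lborel) = \<infinity>"
  proof (rule nn_integral_infinite_if_bounded_below_on_balls
      [where p = "\<lambda>t. t *\<^sub>R (- a)" and r = "b / M" and C = ?C])
    show "0 < ?C" using fin by (simp add: card_gt_0_iff)
    show "0 < b / M" using ab M by simp
    fix t y assume t: "t \<ge> 0" and y: "y \<in> ball (t *\<^sub>R (- a)) (b / M * t)"
    define z where "z = y - t *\<^sub>R (- a)"
    have yz: "y = t *\<^sub>R (- a) + z" by (simp add: z_def)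
    have "norm z \<le> b / M * t" using y by (simp add: z_def dist_norm norm_minus_commute)
    then have z: "M * norm z \<le> b * t" using M(1) by (simp add: field_simps)
    \<comment> \<open>The radius \<open>b t / M\<close> is what keeps the Lipschitz error below the gain \<open>b t\<close>.\<close>
    have "?g y \<le> c * (t * support_fun F (- a) + M * norm z)
        + (1 - c) * (t * support_fun U (- a) + M * norm z)"
      unfolding yz using fin t M c by (intro add_mono mult_left_mono support_fun_perturbation) auto
    also have "\<dots> = t * ?g (- a) + M * norm z" by (simp add: algebra_simps)
    also have "\<dots> \<le> t * (- b) + M * norm z" using mult_left_mono[OF g t] by simp
    also have "\<dots> \<le> 0" using z by (simp add: ac_simps)
    finally have "1 \<le> exp (- ?g y)" by simp
    then have "?C * 1 \<le> ?C * exp (- ?g y)" by (intro mult_left_mono) auto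
    with integrand_lower[OF fin k c, of y]
    show "?C \<le> (\<Sum>u\<in>F. exp ((real k *\<^sub>R u) \<bullet> y)) powr (- c / real k) /
         (\<Sum>u\<in>U. exp ((real k *\<^sub>R u) \<bullet> y)) powr ((1 - c) / real k)"
      by simp
  qed
  with int show False by simp
qed

text \<open>
  With \<open>0\<close> in the combination at \<open>c\<close>, the exponent at \<open>c\<close> is nonnegative. Scaling it by
  \<open>c' / c\<close> gives the correct multiple of the support function of \<open>F\<close>, and leaves over
  \<open>(1 - c') - (c' / c) * (1 - c) = 1 - c' / c > 0\<close> times the support function of \<open>U\<close>, which grows
  linearly.
\<close>
lemma integral_finite_below_combination:
  fixes F U :: "'a::euclidean_space set"
  assumes fin: "finite F" "F \<noteq> {}" "finite U" "U \<noteq> {}" and k: "k \<ge> 1"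
    and U: "0 \<in> interior (convex hull U)"
    and c: "0 < c" "c < 1" and c': "0 < c'" "c' < c"
    and zero: "0 \<in> (*\<^sub>R) (1 - c) ` (convex hull U) + (*\<^sub>R) c ` (convex hull F)"
  shows "(\<integral>\<^sup>+ x. ennreal
        ((\<Sum>u\<in>F. exp ((real k *\<^sub>R u) \<bullet> x)) powr (- c' / real k) /
         (\<Sum>u\<in>U. exp ((real k *\<^sub>R u) \<bullet> x)) powr ((1 - c') / real k)) \<partial>lborel) < \<infinity>"
proof -
  obtain r where r: "r > 0" "cball 0 r \<subseteq> convex hull U"
    using U by (meson mem_interior_cball)
  define e where "e = (1 - c' / c) * r"
  have e: "e > 0" using c c' r by (simp add: e_def)
  obtain u f where uf: "u \<in> convex hull U" "f \<in> convex hull F" "0 = (1 - c) *\<^sub>R u + c *\<^sub>R f"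
    using zero by (auto elim!: set_plus_elim)
  have coercive: "e * norm x \<le> c' * support_fun F x + (1 - c') * support_fun U x" for x
  proof -
    have "0 = ((1 - c) *\<^sub>R u + c *\<^sub>R f) \<bullet> x"
      using uf(3) by (metis inner_zero_left)
    also have "\<dots> = (1 - c) * (u \<bullet> x) + c * (f \<bullet> x)"
      by (simp add: inner_add_left)
    also have "\<dots> \<le> (1 - c) * support_fun U x + c * support_fun F x"
      using fin uf c by (intro add_mono mult_left_mono support_fun_upper) auto
    finally have "0 \<le> c' / c * ((1 - c) * support_fun U x + c * support_fun F x)"
      using c c' by (intro mult_nonneg_nonneg) auto
    moreover have "(1 - c' / c) * (r * norm x) \<le> (1 - c' / c) * support_fun U x"
      using c c' r fin by (intro mult_left_mono support_fun_ge_norm) auto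
    moreover have "c' * support_fun F x + (1 - c') * support_fun U x
       = c' / c * ((1 - c) * support_fun U x + c * support_fun F x) + (1 - c' / c) * support_fun U x"
      using c by (simp add: field_simps)
    ultimately show ?thesis by (simp add: e_def)
  qed
  have "(\<integral>\<^sup>+ x. ennreal
        ((\<Sum>u\<in>F. exp ((real k *\<^sub>R u) \<bullet> x)) powr (- c' / real k) /
         (\<Sum>u\<in>U. exp ((real k *\<^sub>R u) \<bullet> x)) powr ((1 - c') / real k)) \<partial>lborel)
    \<le> (\<integral>\<^sup>+ (x::'a). ennreal (exp (- e * norm x)) \<partial>lborel)"
  proof (intro nn_integral_mono ennreal_leI)
    fix x :: 'a
    show "(\<Sum>u\<in>F. exp ((real k *\<^sub>R u) \<bullet> x)) powr (- c' / real k) /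
         (\<Sum>u\<in>U. exp ((real k *\<^sub>R u) \<bullet> x)) powr ((1 - c') / real k) \<le> exp (- e * norm x)"
      using c c' coercive[of x] by (intro order_trans[OF integrand_upper[OF fin k]]) auto
  qed
  also have "\<dots> < \<infinity>" by (rule nn_integral_exp_neg_norm_finite[OF e])
  finally show ?thesis .
qed

lemma zero_in_combination_iff:
  fixes A B :: "'a::real_vector set"
  assumes "c < 1"
  shows "0 \<in> (*\<^sub>R) (1 - c) ` A + (*\<^sub>R) c ` B
     \<longleftrightarrow> (*\<^sub>R) (- (c / (1 - c))) ` B \<inter> A \<noteq> {}"
proof -
  have eq: "0 = (1 - c) *\<^sub>R u + c *\<^sub>R f \<longleftrightarrow> u = (- (c / (1 - c))) *\<^sub>R f" for u f :: 'a
  proof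
    assume "0 = (1 - c) *\<^sub>R u + c *\<^sub>R f"
    then have "(1 - c) *\<^sub>R u = - (c *\<^sub>R f)" by (simp add: eq_neg_iff_add_eq_0)
    then have "inverse (1 - c) *\<^sub>R ((1 - c) *\<^sub>R u) = inverse (1 - c) *\<^sub>R (- (c *\<^sub>R f))" by simp
    then show "u = (- (c / (1 - c))) *\<^sub>R f" using assms by (simp add: divide_inverse ac_simps)
  next
    assume "u = (- (c / (1 - c))) *\<^sub>R f"
    then show "0 = (1 - c) *\<^sub>R u + c *\<^sub>R f" using assms by simp
  qed
  show ?thesis
    by (auto simp: set_plus_def eq image_iff)
qed

lemma ex_combination_containing_zero:
  fixes F U :: "'a::euclidean_space set"
  assumes "F \<noteq> {}" "0 \<in> interior (convex hull U)"
  shows "\<exists>c. 0 < c \<and> c < 1 \<and> (*\<^sub>R) (- (c / (1 - c))) ` (convex hull F) \<inter> convex hull U \<noteq> {}"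
proof -
  obtain r where r: "r > 0" "cball 0 r \<subseteq> convex hull U"
    using assms by (meson mem_interior_cball)
  obtain f where f: "f \<in> F" using assms by auto
  \<comment> \<open>\<open>s\<close> shrinks \<open>- f\<close> into the ball (the \<open>+ 1\<close> covers \<open>f = 0\<close>), and \<open>c\<close> solves \<open>c / (1 - c) = s\<close>.\<close>
  define s where "s = r / (norm f + 1)"
  define c where "c = s / (1 + s)"
  have s: "s > 0" using r by (simp add: s_def add_nonneg_pos)
  have c: "0 < c" "c < 1" "c / (1 - c) = s" using s by (auto simp: c_def field_simps)
  have "s * norm f \<le> s * (norm f + 1)" using s by (intro mult_left_mono) auto
  also have "\<dots> = r" by (simp add: s_def add_nonneg_eq_0_iff)
  finally have "(- (c / (1 - c))) *\<^sub>R f \<in> convex hull U"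
    using r s unfolding c(3) by (auto simp: subset_iff)
  then show ?thesis using f c(1,2) by (blast intro: hull_inc)
qed

text \<open>
  The parameters with finite integral satisfy the condition on \<open>0\<close>, and conversely every parameter
  below one that satisfies the condition has finite integral. The two sets may differ, but
  only by the endpoint, so the suprema agree.
\<close>
lemma c_exponent_eq:
  fixes F U :: "(real ^ 'n) set"
  assumes fin: "finite F" "F \<noteq> {}" "finite U" "U \<noteq> {}"
    and U: "0 \<in> interior (convex hull U)" and k: "k \<ge> 1"
  shows "c_exponent k F U =
      (SUP c \<in> {c::real. 0 < c \<and> c < 1 \<and>
        0 \<in> (*\<^sub>R) (1 - c) ` (convex hull U) + (*\<^sub>R) c ` (convex hull F)}. ereal c)"
    (is "_ = (SUP c \<in> ?B. ereal c)")
proof (rule antisym)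
  show "c_exponent k F U \<le> (SUP c \<in> ?B. ereal c)"
    unfolding c_exponent_def
    using zero_in_combination_if_integral_finite[OF fin k] by (intro SUP_subset_mono) auto
  show "(SUP c \<in> ?B. ereal c) \<le> c_exponent k F U"
  proof (intro SUP_least)
    fix c assume c: "c \<in> ?B"
    show "ereal c \<le> c_exponent k F U"
    proof (rule dense_le_bounded)
      show "0 < ereal c" using c by simp
      fix w assume w: "0 < w" "w < ereal c"
      then obtain c' where c': "w = ereal c'" by (cases w) auto
      show "w \<le> c_exponent k F U"
        unfolding c_exponent_def c'
        using w c c' integral_finite_below_combination[OF fin k U, of c c'] by (intro SUP_upper) auto
    qed
  qed
qed

theorem proposition6p2:
  fixes F U :: "(real ^ 'n) set" and k :: nat
  assumes "finite F" and "F \<noteq> {}" and "finite U" and "U \<noteq> {}"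
    and "0 \<in> interior (convex hull U)"
    and "k \<ge> 1"
  shows "c_exponent k F U =
      (SUP c \<in> {c::real. 0 < c \<and> c < 1 \<and>
        0 \<in> (*\<^sub>R) (1 - c) ` (convex hull U) + (*\<^sub>R) c ` (convex hull F)}. ereal c)
    \<and> (SUP c \<in> {c::real. 0 < c \<and> c < 1 \<and>
        0 \<in> (*\<^sub>R) (1 - c) ` (convex hull U) + (*\<^sub>R) c ` (convex hull F)}. ereal c) =
      (SUP c \<in> {c::real. 0 < c \<and> c < 1 \<and>
        (*\<^sub>R) (- (c / (1 - c))) ` (convex hull F) \<inter> convex hull U \<noteq> {}}. ereal c)
    \<and> (SUP c \<in> {c::real. 0 < c \<and> c < 1 \<and>
        (*\<^sub>R) (- (c / (1 - c))) ` (convex hull F) \<inter> convex hull U \<noteq> {}}. ereal c) > 0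
    \<and> (\<forall>j\<ge>1. c_exponent j F U = c_exponent k F U)"
proof (intro conjI allI impI)
  show "c_exponent k F U = (SUP c \<in> {c::real. 0 < c \<and> c < 1 \<and>
        0 \<in> (*\<^sub>R) (1 - c) ` (convex hull U) + (*\<^sub>R) c ` (convex hull F)}. ereal c)"
    by (rule c_exponent_eq[OF assms])
  show "(SUP c \<in> {c::real. 0 < c \<and> c < 1 \<and>
        0 \<in> (*\<^sub>R) (1 - c) ` (convex hull U) + (*\<^sub>R) c ` (convex hull F)}. ereal c) =
      (SUP c \<in> {c::real. 0 < c \<and> c < 1 \<and>
        (*\<^sub>R) (- (c / (1 - c))) ` (convex hull F) \<inter> convex hull U \<noteq> {}}. ereal c)"
    by (intro arg_cong[where f = "\<lambda>A. SUP c\<in>A. ereal c"] Collect_cong conj_cong refl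
        zero_in_combination_iff)
  show "(SUP c \<in> {c::real. 0 < c \<and> c < 1 \<and>
        (*\<^sub>R) (- (c / (1 - c))) ` (convex hull F) \<inter> convex hull U \<noteq> {}}. ereal c) > 0"
    using ex_combination_containing_zero[OF assms(2,5)] by (auto simp: less_SUP_iff)
  show "c_exponent j F U = c_exponent k F U" if "j \<ge> 1" for j
    using c_exponent_eq[OF assms(1-5) that] c_exponent_eq[OF assms] by simp
qed

end
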